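(* Let $E$ be a power quasi-Banach function space (power Q-BFS) on $\mathbb{R}^n$ with absolutely continuous quasi-norm. Let $\mathcal{F}\subset E$ be a family satisfying the following conditions: (a) $\mathcal{F}$ is bounded, i.e. $\sup_{f\in\mathcal{F}}\|f\|_E<\infty$; (b) $\mathcal{F}$ uniformly vanishes at infinity, that is, $\lim_{N\to\infty}\sup_{f\in\mathcal{F}}\|f\chi_{B^c(0,N)}\|_E=0$; (c) $\mathcal{F}$ is equicontinuous, that is, $\lim_{r\to0}\sup_{f\in\mathcal{F}}\sup_{y\in B(0,r)}\|\tau_yf-f\|_E=0$. Then $\mathcal{F}$ is a totally bounded subset of $E$.
   Context: Let $m$ be Lebesgue measure on $\mathbb{R}^n$, $L(m)$ the class of Lebesgue measurable functions on $\mathbb{R}^n$ (functions equal a.e. are identified), and $L^0(m)$ the class of functions in $L(m)$ that are finite a.e. $B(0,r)$ is the open Euclidean ball of radius $r$ centered at $0$, $B^c(0,N)=\mathbb{R}^n\setminus B(0,N)$, $\chi_A$ is the indicator function of $A$, and $\tau_yf(x)=f(x-y)$. A quasi-Banach function space (Q-BFS), respectively Banach function space (BFS), is a quasi-normed, respectively normed, space $(E,\|\cdot\|_E)$ with $E\subset L(m)$ such that (with the convention that $\|f\|_E$ is defined in $[0,\infty]$ for all $f\in L(m)$ and $f\in E$ if and only if $\|f\|_E<\infty$): (B0) $\|f\|_E=0$ if and only if $f=0$ a.e.; (B1) $\||f|\|_E=\|f\|_E$; (B2) if $0\le g\le f$ a.e., then $\|g\|_E\le\|f\|_E$; (B3)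 if $0\le f_n\uparrow f$ a.e., then $\|f_n\|_E\uparrow\|f\|_E$; (B4) if $A\subset\mathbb{R}^n$ is a bounded measurable set, then $\chi_A\in E$. (Elements of $E$ are then finite a.e., and $E$ is complete.) No inequality of the form $\int_A|f|\,dx\le C(A)\|f\|_E$ is assumed. A Q-BFS $E$ is a power Q-BFS if there is a constant $b\in(0,1]$ such that $\|f\|_{E^b}:=\||f|^{1/b}\|_E^{\,b}$ is a norm and the corresponding space $E^b\subset L^0(m)$ of measurable functions $f$ with $\|f\|_{E^b}<\infty$ is a BFS. $E$ has absolutely continuous quasi-norm if for every $f\in E$ and every sequence of measurable sets $A_k$ with $A_k\to\emptyset$ (i.e. $\chi_{A_k}\to0$ a.e.) one has $\|f\chi_{A_k}\|_E\to0$. *)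

theory Defs
  imports "HOL-Analysis.Analysis"
begin

text \<open>
  Measurable functions are extended real valued and are represented by actual functions rather
  than by classes modulo almost everywhere equality.  A gauge \<open>N\<close> plays the role of the extended
  quasi-norm \<open>f \<mapsto> \<parallel>f\<parallel>\<close>; its values outside \<open>L_class\<close> are never used.  By (B1) and (B2) below,
  \<open>N\<close> respects almost everywhere equality on \<open>L_class\<close>.  Elements of the space are finite almost
  everywhere, so the value that \<^typ>\<open>ereal\<close> assigns to \<open>\<infinity> - \<infinity>\<close> in sums and differences
  is irrelevant.
\<close>

type_synonym 'n fn = "real ^ 'n \<Rightarrow> ereal"
type_synonym 'n gauge = "'n fn \<Rightarrow> ennreal"

definition L_class :: "('n::finite) fn set" where
  "L_class = borel_measurable lebesgue"

definition L0_class :: "('n::finite) fn set" where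
  "L0_class = {f \<in> L_class. AE x in lebesgue. \<bar>f x\<bar> \<noteq> \<infinity>}"

definition carrier_of :: "('n::finite) gauge \<Rightarrow> 'n fn set" where
  "carrier_of N = {f \<in> L_class. N f < \<infinity>}"

definition restrict_fn :: "(real ^ 'n) set \<Rightarrow> ('n::finite) fn \<Rightarrow> 'n fn" where
  "restrict_fn A f = (\<lambda>x. f x * indicator A x)"

definition translate :: "real ^ 'n \<Rightarrow> ('n::finite) fn \<Rightarrow> 'n fn" where
  "translate y f = (\<lambda>x. f (x - y))"

text \<open>Closure of the carrier under addition and scalar multiplication follows, because the
  right-hand sides are finite.\<close>

definition quasi_norm_const :: "real \<Rightarrow> ('n::finite) gauge \<Rightarrow> bool" where
  "quasi_norm_const C N \<longleftrightarrow>
     (\<forall>f\<in>carrier_of N. N f = 0 \<longleftrightarrow> (AE x in lebesgue. f x = 0)) \<and>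
     (\<forall>f\<in>carrier_of N. \<forall>c::real. N (\<lambda>x. ereal c * f x) = ennreal \<bar>c\<bar> * N f) \<and>
     (\<forall>f\<in>carrier_of N. \<forall>g\<in>carrier_of N. N (\<lambda>x. f x + g x) \<le> ennreal C * (N f + N g))"

definition is_quasi_norm :: "('n::finite) gauge \<Rightarrow> bool" where
  "is_quasi_norm N \<longleftrightarrow> (\<exists>C\<ge>1. quasi_norm_const C N)"

definition is_norm :: "('n::finite) gauge \<Rightarrow> bool" where
  "is_norm N \<longleftrightarrow> quasi_norm_const 1 N"

definition function_space_axioms :: "('n::finite) gauge \<Rightarrow> bool" where
  "function_space_axioms N \<longleftrightarrow>
     \<comment> \<open>(B0)\<close>
     (\<forall>f\<in>L_class. N f = 0 \<longleftrightarrow> (AE x in lebesgue. f x = 0)) \<and>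
     \<comment> \<open>(B1)\<close>
     (\<forall>f\<in>L_class. N (\<lambda>x. \<bar>f x\<bar>) = N f) \<and>
     \<comment> \<open>(B2)\<close>
     (\<forall>f\<in>L_class. \<forall>g\<in>L_class. (AE x in lebesgue. 0 \<le> g x \<and> g x \<le> f x) \<longrightarrow> N g \<le> N f) \<and>
     \<comment> \<open>(B3)\<close>
     (\<forall>F f. (\<forall>k::nat. F k \<in> L_class) \<and> f \<in> L_class \<and>
        (AE x in lebesgue. (\<forall>k. 0 \<le> F k x) \<and> incseq (\<lambda>k. F k x) \<and> (\<lambda>k. F k x) \<longlonglongrightarrow> f x)
        \<longrightarrow> incseq (\<lambda>k. N (F k)) \<and> (\<lambda>k. N (F k)) \<longlonglongrightarrow> N f) \<and>
     \<comment> \<open>(B4)\<close>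
     (\<forall>A. bounded A \<and> A \<in> sets lebesgue \<longrightarrow> indicator A \<in> carrier_of N)"

definition QBFS :: "('n::finite) gauge \<Rightarrow> bool" where
  "QBFS N \<longleftrightarrow> is_quasi_norm N \<and> function_space_axioms N"

definition BFS :: "('n::finite) gauge \<Rightarrow> bool" where
  "BFS N \<longleftrightarrow> is_norm N \<and> function_space_axioms N"

text \<open>The power function on \<open>[0, \<infinity>]\<close>, used for exponents \<open>p > 0\<close> only.\<close>

definition ennreal_power :: "ennreal \<Rightarrow> real \<Rightarrow> ennreal" where
  "ennreal_power x p = (if x = \<infinity> then \<infinity> else ennreal (enn2real x powr p))"

definition power_gauge :: "real \<Rightarrow> ('n::finite) gauge \<Rightarrow> 'n gauge" where
  "power_gauge b N f =
     ennreal_power (N (\<lambda>x. enn2ereal (ennreal_power (e2ennreal \<bar>f x\<bar>) (1 / b)))) b"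

definition power_QBFS :: "('n::finite) gauge \<Rightarrow> bool" where
  "power_QBFS N \<longleftrightarrow> QBFS N \<and>
     (\<exists>b. 0 < b \<and> b \<le> 1 \<and> carrier_of (power_gauge b N) \<subseteq> L0_class \<and> BFS (power_gauge b N))"

definition absolutely_continuous_gauge :: "('n::finite) gauge \<Rightarrow> bool" where
  "absolutely_continuous_gauge N \<longleftrightarrow>
     (\<forall>f\<in>carrier_of N. \<forall>A::nat \<Rightarrow> (real ^ 'n) set.
        (\<forall>k. A k \<in> sets lebesgue) \<and>
        (AE x in lebesgue. (\<lambda>k. indicator (A k) x :: real) \<longlonglongrightarrow> 0)
        \<longrightarrow> (\<lambda>k. N (restrict_fn (A k) f)) \<longlonglongrightarrow> 0)"

text \<open>A quasi-norm does not induce a metric, so the library's \<open>mtotally_bounded\<close> does not apply: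
  every \<open>\<epsilon> > 0\<close> admits a finite \<open>\<epsilon>\<close>-net in the space.\<close>

definition totally_bounded_in :: "('n::finite) gauge \<Rightarrow> 'n fn set \<Rightarrow> bool" where
  "totally_bounded_in N \<F> \<longleftrightarrow> \<F> \<subseteq> carrier_of N \<and>
     (\<forall>\<epsilon>::real. \<epsilon> > 0 \<longrightarrow>
        (\<exists>K. finite K \<and> K \<subseteq> carrier_of N \<and>
             (\<forall>f\<in>\<F>. \<exists>g\<in>K. N (\<lambda>x. f x - g x) < ennreal \<epsilon>)))"

end

theory Submission
  imports Defs "HOL-Probability.Probability"
begin

text \<open>
  Passing to \<open>X = E\<^sup>b\<close>, whose norm satisfies \<open>\<parallel>\<bar>f\<bar>\<^sup>b\<parallel> = \<parallel>f\<parallel>\<^sup>b\<close>, makes the triangle inequality and the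
  Fatou property available.  On a grid of small cubes \<open>Q\<close> replace \<open>f\<close> by its medians \<open>m\<close>: for \<open>x\<close>
  in \<open>Q\<close>, at least half of the points \<open>t\<close> of \<open>Q\<close> satisfy \<open>\<bar>f x - m\<bar> \<le> \<bar>f x - f t\<bar>\<close>, so
  \<open>\<bar>f x - m\<bar>\<^sup>b\<close> is at most a dimensional constant times an average of \<open>\<bar>f x - f (x - y)\<bar>\<^sup>b\<close> over a
  small box of translations \<open>y\<close>, and equicontinuity makes the step function of medians a good
  approximation to \<open>f\<close> on a bounded union of cubes.  Outside that union \<open>f\<close> is uniformly small,
  and the medians are bounded uniformly in \<open>f\<close>, so finitely many step functions suffice.
\<close>

subsection \<open>Medians and sampling\<close>

text \<open>The median is the least point where the distribution function reaches 1/2: right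
  continuity gives mass at least 1/2 up to and including it, and the left limit gives mass at most
  1/2 strictly below it.\<close>

lemma (in prob_space) median_exists:
  fixes f :: "'a \<Rightarrow> real"
  assumes [measurable]: "f \<in> borel_measurable M"
  shows "\<exists>a. 1 / 2 \<le> prob {x \<in> space M. f x \<le> a} \<and> 1 / 2 \<le> prob {x \<in> space M. a \<le> f x}"
proof -
  define D where "D = distr M borel f"
  interpret D: real_distribution D
    unfolding D_def by (rule real_distribution_distr) simp
  have D_eq: "measure D A = prob {x \<in> space M. f x \<in> A}" if "A \<in> sets borel" for A
    unfolding D_def using that by (subst measure_distr) (auto intro!: arg_cong[where f=prob])
  have "eventually (\<lambda>x. cdf D x > 1 / 2) at_top"
    by (rule order_tendstoD[OF D.cdf_lim_at_top_prob]) simp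
  then obtain a1 where a1: "cdf D a1 > 1 / 2"
    using eventually_happens by fastforce
  have "eventually (\<lambda>x. cdf D x < 1 / 2) at_bot"
    by (rule order_tendstoD[OF D.cdf_lim_at_bot]) simp
  then obtain a0 where a0: "\<And>x. x \<le> a0 \<Longrightarrow> cdf D x < 1 / 2"
    by (auto simp: eventually_at_bot_linorder)
  define S where "S = {x. 1 / 2 \<le> cdf D x}"
  have "a1 \<in> S" using a1 unfolding S_def mem_Collect_eq by linarith
  then have ne: "S \<noteq> {}" by blast
  have bdd: "bdd_below S"
  proof (rule bdd_belowI[where m=a0])
    fix x assume "x \<in> S"
    then show "a0 \<le> x" using a0[of x] by (force simp: S_def)
  qed
  define a where "a = Inf S"
  have above: "1 / 2 \<le> cdf D x" if "a < x" for x
  proof -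
    from that obtain z where z: "z \<in> S" "z < x"
      unfolding a_def using ne bdd by (meson cInf_less_iff)
    then show ?thesis using D.cdf_nondecreasing[of z x] by (auto simp: S_def)
  qed
  have below: "cdf D x < 1 / 2" if "x < a" for x
    using that bdd unfolding a_def S_def by (meson cInf_lower not_le mem_Collect_eq)
  have "(cdf D \<longlongrightarrow> cdf D a) (at_right a)"
    using D.cdf_is_right_cont[of a] by (simp add: continuous_within)
  then have 1: "1 / 2 \<le> cdf D a"
    by (rule tendsto_lowerbound[OF _ eventually_mono[OF eventually_at_right_less above]]) auto
  have "eventually (\<lambda>x. cdf D x \<le> 1 / 2) (at_left a)"
    unfolding eventually_at_filter by (intro always_eventually allI impI less_imp_le[OF below]) simp
  then have 2: "measure D {..<a} \<le> 1 / 2"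
    by (rule tendsto_upperbound[OF D.cdf_at_left]) simp
  have "measure D {a..} = 1 - measure D {..<a}"
    by (subst D.prob_compl[symmetric]) (auto intro!: arg_cong[where f="measure D"])
  with 1 2 show ?thesis
    by (intro exI[of _ a]) (simp add: cdf_def D_eq)
qed

text \<open>The sample points are chosen one at a time, each new one keeping the accumulated variance at
  most its mean; this replaces an independent sequence on an infinite product space.\<close>

lemma sample_average_variance:
  fixes h :: "'a \<times> 'b \<Rightarrow> real"
  assumes P: "prob_space P" and Q: "prob_space Q"
    and [measurable]: "h \<in> borel_measurable (P \<Otimes>\<^sub>M Q)"
    and h: "\<And>z. 0 \<le> h z" "\<And>z. h z \<le> 1"
    and G: "AE y in Q. G y"
  shows "\<exists>y. (\<forall>i<k. y i \<in> space Q \<and> G (y i)) \<and>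
    (\<integral>x. (\<Sum>i<k. h (x, y i) - (\<integral>t. h (x, t) \<partial>Q))\<^sup>2 \<partial>P) \<le> real k"
proof (induction k)
  case 0
  then show ?case by simp
next
  case (Suc k)
  interpret P: prob_space P by fact
  interpret Q: prob_space Q by fact
  interpret PQ: pair_prob_space P Q ..
  from Suc obtain y where y: "\<And>i. i < k \<Longrightarrow> y i \<in> space Q \<and> G (y i)"
    and int: "(\<integral>x. (\<Sum>i<k. h (x, y i) - (\<integral>t. h (x, t) \<partial>Q))\<^sup>2 \<partial>P) \<le> real k" by blast
  \<comment> \<open>\<open>g\<close> centres each sample at its mean over \<open>Q\<close>, and
    \<open>D\<close> is the deviation accumulated by the samples already chosen.\<close>
  define g where "g x t = h (x, t) - (\<integral>t. h (x, t) \<partial>Q)" for x t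
  define D where "D x = (\<Sum>i<k. g x (y i))" for x
  have hbar_meas [measurable]: "(\<lambda>x. \<integral>t. h (x, t) \<partial>Q) \<in> borel_measurable P"
    by measurable
  have [measurable]: "(\<lambda>x. g x (y i)) \<in> borel_measurable P" if "i < k" for i
  proof -
    have [measurable]: "(\<lambda>x. (x, y i)) \<in> P \<rightarrow>\<^sub>M P \<Otimes>\<^sub>M Q"
      using y[OF that] by (intro measurable_Pair2') simp
    show ?thesis unfolding g_def by measurable
  qed
  have [measurable]: "D \<in> borel_measurable P" unfolding D_def by measurable
  have [measurable]: "(\<lambda>(x, t). g x t) \<in> borel_measurable (P \<Otimes>\<^sub>M Q)" unfolding g_def by measurable
  have hbar: "0 \<le> (\<integral>t. h (x, t) \<partial>Q)" "(\<integral>t. h (x, t) \<partial>Q) \<le> 1" if "x \<in> space P" for x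
  proof -
    show "0 \<le> (\<integral>t. h (x, t) \<partial>Q)" by (simp add: h)
    have "integrable Q (\<lambda>t. h (x, t))"
      using that by (intro Q.integrable_const_bound[where B=1]) (auto simp: h)
    then show "(\<integral>t. h (x, t) \<partial>Q) \<le> 1"
      using h by (intro Q.integral_le_const) auto
  qed
  have g1: "\<bar>g x t\<bar> \<le> 1" if "x \<in> space P" for x t
    using hbar[OF that] h[of "(x, t)"] by (auto simp: g_def)
  have D1: "\<bar>D x\<bar> \<le> real k" if "x \<in> space P" for x
    unfolding D_def
    using order_trans[OF sum_abs sum_mono[of "{..<k}" "\<lambda>i. \<bar>g x (y i)\<bar>" "\<lambda>_. 1"]] g1[OF that] by simp
  have g_int: "integrable Q (\<lambda>t. g x t)" "(\<integral>t. g x t \<partial>Q) = 0" if "x \<in> space P" for x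
  proof -
    have *: "integrable Q (\<lambda>t. h (x, t))"
      using that by (intro Q.integrable_const_bound[where B=1]) (auto simp: h)
    show "integrable Q (\<lambda>t. g x t)" "(\<integral>t. g x t \<partial>Q) = 0"
      unfolding g_def using * by (auto simp: Q.prob_space)
  qed
  have g2_int: "integrable Q (\<lambda>t. (g x t)\<^sup>2)" if "x \<in> space P" for x
    using that g1[OF that] by (intro Q.integrable_const_bound[where B=1]) (auto simp: abs_square_le_1)
  have D2_int: "integrable P (\<lambda>x. (D x)\<^sup>2)"
  proof (rule P.integrable_const_bound[where B="(real k)\<^sup>2"])
    show "AE x in P. norm ((D x)\<^sup>2) \<le> (real k)\<^sup>2"
    proof (rule AE_I2)
      fix x assume "x \<in> space P"
      then show "norm ((D x)\<^sup>2) \<le> (real k)\<^sup>2"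
        using power_mono[OF D1, of x 2] by simp
    qed
  qed simp
  have F_int: "integrable (P \<Otimes>\<^sub>M Q) (\<lambda>(x, t). (D x + g x t)\<^sup>2)"
  proof (rule PQ.integrable_const_bound[where B="(real k + 1)\<^sup>2"])
    show "AE z in P \<Otimes>\<^sub>M Q. norm (case z of (x, t) \<Rightarrow> (D x + g x t)\<^sup>2) \<le> (real k + 1)\<^sup>2"
    proof (rule AE_I2)
      fix z assume "z \<in> space (P \<Otimes>\<^sub>M Q)"
      then obtain x t where z: "z = (x, t)" "x \<in> space P" by (auto simp: space_pair_measure)
      have "\<bar>D x + g x t\<bar> \<le> real k + 1" using D1[OF z(2)] g1[OF z(2), of t] by linarith
      from power_mono[OF this, of 2]
      show "norm (case z of (x, t) \<Rightarrow> (D x + g x t)\<^sup>2) \<le> (real k + 1)\<^sup>2" by (simp add: z)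
    qed
  qed measurable
  \<comment> \<open>Since \<open>g x\<close> has mean zero over \<open>Q\<close>, the mixed term
    integrates to zero; as \<open>g\<close> is bounded by 1, one more sample adds at most 1.\<close>
  have inner: "(\<integral>t. (D x + g x t)\<^sup>2 \<partial>Q) \<le> (D x)\<^sup>2 + 1" if "x \<in> space P" for x
  proof -
    have "(\<integral>t. (D x + g x t)\<^sup>2 \<partial>Q) = (\<integral>t. (D x)\<^sup>2 + 2 * D x * g x t + (g x t)\<^sup>2 \<partial>Q)"
      by (simp add: power2_sum algebra_simps)
    also have "\<dots> = (D x)\<^sup>2 + (\<integral>t. (g x t)\<^sup>2 \<partial>Q)"
      using g_int[OF that] g2_int[OF that] by (simp add: Q.prob_space)
    also have "(\<integral>t. (g x t)\<^sup>2 \<partial>Q) \<le> 1"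
      using g2_int[OF that] g1[OF that] by (intro Q.integral_le_const) (auto simp: abs_square_le_1)
    finally show ?thesis by simp
  qed
  have "(\<integral>t. (\<integral>x. (D x + g x t)\<^sup>2 \<partial>P) \<partial>Q) = (\<integral>x. (\<integral>t. (D x + g x t)\<^sup>2 \<partial>Q) \<partial>P)"
    by (rule PQ.Fubini_integral[OF F_int])
  also have "\<dots> \<le> (\<integral>x. (D x)\<^sup>2 + 1 \<partial>P)"
    using PQ.integrable_fst[OF F_int] D2_int inner by (intro integral_mono) auto
  also have "\<dots> \<le> real (Suc k)"
    using D2_int int by (simp add: P.prob_space D_def g_def)
  finally have F: "(\<integral>t. (\<integral>x. (D x + g x t)\<^sup>2 \<partial>P) \<partial>Q) \<le> real (Suc k)" .
  \<comment> \<open>The new sample comes from comparison with the mean: if every \<open>t\<close>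
    satisfying \<open>G\<close> gave more than \<open>Suc k\<close>, then so would almost every
    \<open>t\<close>, and the mean over \<open>t\<close> would exceed \<open>Suc k\<close>.\<close>
  have "\<exists>t. t \<in> space Q \<and> G t \<and> (\<integral>x. (D x + g x t)\<^sup>2 \<partial>P) \<le> real (Suc k)"
  proof (rule ccontr)
    assume "\<not> ?thesis"
    with G have "AE t in Q. real (Suc k) < (\<integral>x. (D x + g x t)\<^sup>2 \<partial>P)"
      by (auto simp: not_le)
    from Q.expectation_greater[OF _ this] PQ.integrable_snd[OF F_int] F show False by auto
  qed
  then obtain t where t: "t \<in> space Q" "G t" "(\<integral>x. (D x + g x t)\<^sup>2 \<partial>P) \<le> real (Suc k)" by blast
  show ?case
    using y t by (intro exI[of _ "y(k := t)"]) (auto simp: less_Suc_eq D_def g_def)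
qed

text \<open>The averages converge to the mean in mean square, hence almost everywhere along a
  subsequence \<open>r\<close>. The samples form a triangular array: each \<open>k\<close> has its
  own row, and all its entries satisfy \<open>G\<close>.\<close>

lemma sample_average_AE:
  fixes h :: "'a \<times> 'b \<Rightarrow> real"
  assumes P: "prob_space P" and Q: "prob_space Q"
    and [measurable]: "h \<in> borel_measurable (P \<Otimes>\<^sub>M Q)"
    and h: "\<And>z. 0 \<le> h z" "\<And>z. h z \<le> 1"
    and G: "AE y in Q. G y"
  obtains y :: "nat \<Rightarrow> nat \<Rightarrow> 'b" and r :: "nat \<Rightarrow> nat"
  where "\<forall>k. \<forall>i<Suc (r k). G (y k i)"
    and "AE x in P. (\<lambda>k. (\<Sum>i<Suc (r k). h (x, y k i)) / real (Suc (r k)))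
           \<longlonglongrightarrow> (\<integral>t. h (x, t) \<partial>Q)"
proof -
  interpret P: prob_space P by fact
  interpret Q: prob_space Q by fact
  define hbar where "hbar x = (\<integral>t. h (x, t) \<partial>Q)" for x
  have [measurable]: "hbar \<in> borel_measurable P" unfolding hbar_def by measurable
  have "\<exists>y. \<forall>k. (\<forall>i<k. y k i \<in> space Q \<and> G (y k i)) \<and>
    (\<integral>x. (\<Sum>i<k. h (x, y k i) - hbar x)\<^sup>2 \<partial>P) \<le> real k"
    unfolding hbar_def by (intro choice allI sample_average_variance assms)
  then obtain y where y: "\<And>k i. i < k \<Longrightarrow> y k i \<in> space Q \<and> G (y k i)"
    and var: "\<And>k. (\<integral>x. (\<Sum>i<k. h (x, y k i) - hbar x)\<^sup>2 \<partial>P) \<le> real k" by blast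
  \<comment> \<open>The sample size is \<open>Suc k\<close>, so that the average never divides by
    zero.\<close>
  define e where "e k x = (\<Sum>i<Suc k. h (x, y (Suc k) i)) / real (Suc k) - hbar x" for k x
  have [measurable]: "(\<lambda>x. h (x, y k i)) \<in> borel_measurable P" if "i < k" for k i
    using measurable_compose[OF measurable_Pair2' assms(3)] y[OF that] by simp
  have e_meas [measurable]: "e k \<in> borel_measurable P" for k
    unfolding e_def by (intro borel_measurable_diff borel_measurable_divide borel_measurable_sum) auto
  have e_eq: "(e k x)\<^sup>2 = (\<Sum>i<Suc k. h (x, y (Suc k) i) - hbar x)\<^sup>2 / (real (Suc k))\<^sup>2" for k x
    unfolding e_def power_divide[symmetric] by (simp only: sum_subtractf) (simp add: field_simps)
  have hbar: "0 \<le> hbar x" "hbar x \<le> 1" if "x \<in> space P" for x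
  proof -
    show "0 \<le> hbar x" by (simp add: h hbar_def)
    have "integrable Q (\<lambda>t. h (x, t))"
      using that by (intro Q.integrable_const_bound[where B=1]) (auto simp: h)
    then show "hbar x \<le> 1"
      unfolding hbar_def using h by (intro Q.integral_le_const) auto
  qed
  have e1: "\<bar>e k x\<bar> \<le> 1" if "x \<in> space P" for x k
  proof -
    have "0 \<le> (\<Sum>i<Suc k. h (x, y (Suc k) i))" by (intro sum_nonneg h)
    moreover have "(\<Sum>i<Suc k. h (x, y (Suc k) i)) \<le> (\<Sum>i<Suc k. 1)" by (intro sum_mono h)
    ultimately have "0 \<le> (\<Sum>i<Suc k. h (x, y (Suc k) i)) / real (Suc k)"
      "(\<Sum>i<Suc k. h (x, y (Suc k) i)) / real (Suc k) \<le> 1"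
      by (simp_all del: sum.lessThan_Suc)
    with hbar[OF that] show ?thesis unfolding e_def by linarith
  qed
  have e_int: "integrable P (\<lambda>x. (e k x)\<^sup>2)" for k
    using e1 by (intro P.integrable_const_bound[where B=1]) (auto simp: abs_square_le_1)
  \<comment> \<open>The accumulated second moment grows only linearly, so dividing by the square of
    the sample size leaves \<open>inverse (real (Suc k))\<close>.\<close>
  have lim: "(\<lambda>k. \<integral>x. norm ((e k x)\<^sup>2) \<partial>P) \<longlonglongrightarrow> 0"
  proof (rule tendsto_sandwich[OF _ _ tendsto_const])
    show "eventually (\<lambda>k. (\<integral>x. norm ((e k x)\<^sup>2) \<partial>P) \<le> inverse (real (Suc k))) sequentially"
    proof (intro always_eventually allI)
      fix k
      have "(\<integral>x. norm ((e k x)\<^sup>2) \<partial>P) =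
        (\<integral>x. (\<Sum>i<Suc k. h (x, y (Suc k) i) - hbar x)\<^sup>2 \<partial>P) / (real (Suc k))\<^sup>2"
        by (simp add: e_eq del: sum.lessThan_Suc of_nat_Suc)
      also have "\<dots> \<le> real (Suc k) / (real (Suc k))\<^sup>2"
        by (intro divide_right_mono var) auto
      also have "\<dots> = inverse (real (Suc k))"
        by (simp add: power2_eq_square divide_inverse del: of_nat_Suc)
      finally show "(\<integral>x. norm ((e k x)\<^sup>2) \<partial>P) \<le> inverse (real (Suc k))" .
    qed
    show "(\<lambda>k. inverse (real (Suc k))) \<longlonglongrightarrow> 0" by (rule LIMSEQ_inverse_real_of_nat)
  qed (simp add: always_eventually)
  obtain r where r: "strict_mono r" "AE x in P. (\<lambda>k. (e (r k) x)\<^sup>2) \<longlonglongrightarrow> 0"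
    using tendsto_L1_AE_subseq[OF e_int lim] by blast
  show thesis
  proof (rule that[of r "\<lambda>k. y (Suc (r k))"])
    show "AE x in P. (\<lambda>k. (\<Sum>i<Suc (r k). h (x, y (Suc (r k)) i)) / real (Suc (r k)))
           \<longlonglongrightarrow> (\<integral>t. h (x, t) \<partial>Q)"
      using r(2)
    proof eventually_elim
      case (elim x)
      then have "(\<lambda>k. e (r k) x) \<longlonglongrightarrow> 0" by (simp add: power_tendsto_0_iff)
      then have "(\<lambda>k. e (r k) x + hbar x) \<longlonglongrightarrow> 0 + hbar x" by (intro tendsto_intros)
      then show ?case by (simp add: e_def hbar_def del: sum.lessThan_Suc of_nat_Suc)
    qed
  qed (use y in auto)
qed

subsection \<open>Gauges on real-valued functions\<close>

lemma ennreal_power_mono: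
  assumes "0 < p" "x \<le> y"
  shows "ennreal_power x p \<le> ennreal_power y p"
proof (cases "y = \<infinity>")
  case True
  then show ?thesis by (simp add: ennreal_power_def)
next
  case False
  moreover have "x \<noteq> \<infinity>" using False assms(2) by (auto simp: top_unique)
  moreover have "enn2real x \<le> enn2real y"
    using False assms(2) by (intro enn2real_mono) (auto simp: less_top)
  ultimately show ?thesis
    using assms(1) by (auto simp: ennreal_power_def intro!: ennreal_leI powr_mono2)
qed

lemma ennreal_power_ennreal:
  "0 \<le> x \<Longrightarrow> ennreal_power (ennreal x) p = ennreal (x powr p)"
  by (simp add: ennreal_power_def)

lemma ennreal_power_less_top: "x < \<infinity> \<Longrightarrow> ennreal_power x p < \<infinity>"
  by (auto simp: ennreal_power_def)

lemma ennreal_power_less_D: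
  assumes "0 < p" "0 \<le> e" "ennreal_power x p < ennreal (e powr p)"
  shows "x < ennreal e"
proof (rule ccontr)
  assume "\<not> x < ennreal e"
  then have "ennreal e \<le> x" by simp
  from ennreal_power_mono[OF assms(1) this] assms show False
    by (simp add: ennreal_power_ennreal)
qed

lemma L_class_ereal [intro]:
  "f \<in> borel_measurable borel \<Longrightarrow> (\<lambda>x. ereal (f x)) \<in> L_class"
  unfolding L_class_def by (intro borel_measurable_ereal measurable_completion) simp

lemma L_class_measurable: "f \<in> L_class \<Longrightarrow> f \<in> borel_measurable lebesgue"
  by (simp add: L_class_def)

section \<open>Monotonicity and the Fatou property\<close>

context
  fixes X :: "('n::finite) gauge"
  assumes fsa: "function_space_axioms X"
begin

text \<open>(B2) compares nonnegative functions; applying it to absolute values and removing these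
  by (B1) gives domination for signed functions.\<close>

lemma gauge_mono:
  assumes fg: "f \<in> L_class" "g \<in> L_class" and le: "AE x in lebesgue. \<bar>g x\<bar> \<le> \<bar>f x\<bar>"
  shows "X g \<le> X f"
proof -
  have "(\<lambda>x. \<bar>f x\<bar>) \<in> L_class" "(\<lambda>x. \<bar>g x\<bar>) \<in> L_class"
    using fg unfolding L_class_def by measurable
  moreover have "AE x in lebesgue. 0 \<le> \<bar>g x\<bar> \<and> \<bar>g x\<bar> \<le> \<bar>f x\<bar>" using le by auto
  moreover have B2: "\<forall>f\<in>L_class. \<forall>g\<in>L_class. (AE x in lebesgue. 0 \<le> g x \<and> g x \<le> f x) \<longrightarrow> X g \<le> X f"
    using fsa unfolding function_space_axioms_def by (elim conjE)
  ultimately have "X (\<lambda>x. \<bar>g x\<bar>) \<le> X (\<lambda>x. \<bar>f x\<bar>)"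
    by (intro B2[rule_format])
  moreover have B1: "\<forall>f\<in>L_class. X (\<lambda>x. \<bar>f x\<bar>) = X f"
    using fsa unfolding function_space_axioms_def by (elim conjE)
  then have "X (\<lambda>x. \<bar>f x\<bar>) = X f" "X (\<lambda>x. \<bar>g x\<bar>) = X g"
    using fg by blast+
  ultimately show ?thesis by simp
qed

lemma gauge_cong_AE:
  assumes "f \<in> L_class" "g \<in> L_class" "AE x in lebesgue. f x = g x"
  shows "X f = X g"
  using assms by (intro antisym gauge_mono) auto

text \<open>The infima over tails increase to the lower limit and lie below the corresponding
  \<open>w k\<close>, so (B3) carries the bound \<open>M\<close> over to \<open>u\<close>.\<close>

lemma gauge_Fatou:
  assumes w: "\<And>k::nat. w k \<in> L_class" "u \<in> L_class"
    and nonneg: "\<And>k x. 0 \<le> w k x"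
    and lim: "AE x in lebesgue. (\<lambda>k. w k x) \<longlonglongrightarrow> u x"
    and M: "\<And>k. X (w k) \<le> M"
  shows "X u \<le> M"
proof -
  define g where "g k x = (INF l\<in>{k..}. w l x)" for k x
  have [measurable]: "w k \<in> borel_measurable lebesgue" for k
    using w(1) by (simp add: L_class_def)
  have g: "g k \<in> L_class" for k
    unfolding L_class_def g_def by measurable
  have g0: "0 \<le> g k x" for k x
    unfolding g_def by (intro INF_greatest nonneg)
  have inc: "incseq (\<lambda>k. g k x)" for x
    unfolding g_def by (intro incseq_SucI INF_superset_mono) auto
  have "AE x in lebesgue. (\<forall>k. 0 \<le> g k x) \<and> incseq (\<lambda>k. g k x) \<and> (\<lambda>k. g k x) \<longlonglongrightarrow> u x"
    using lim
  proof eventually_elim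
    case (elim x)
    have "(SUP k. g k x) = liminf (\<lambda>k. w k x)"
      unfolding g_def by (simp add: liminf_SUP_INF)
    also have "\<dots> = u x" using elim by (intro lim_imp_Liminf) auto
    finally show ?case using g0 inc LIMSEQ_SUP[OF inc, of x] by auto
  qed
  then have lim: "(\<lambda>k. X (g k)) \<longlonglongrightarrow> X u"
    using fsa g w(2) unfolding function_space_axioms_def by blast
  have "X (g k) \<le> M" for k
  proof -
    have "g k x \<le> w k x" for x
      unfolding g_def by (rule INF_lower) simp
    then have "X (g k) \<le> X (w k)"
      using g w(1) g0 nonneg by (intro gauge_mono) auto
    with M[of k] show ?thesis by (rule order_trans[rotated])
  qed
  then show ?thesis using lim by (intro LIMSEQ_le_const2) auto
qed

end

text \<open>The inner exponent \<open>1 / b\<close> undoes the power \<open>b\<close>, and (B1)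
  drops the absolute value. This identity moves every estimate between \<open>N\<close> and its
  normed power.\<close>

lemma power_gauge_powr:
  assumes fsa: "function_space_axioms N" and b: "0 < b" and g: "g \<in> borel_measurable borel"
  shows "power_gauge b N (\<lambda>x. ereal (\<bar>g x\<bar> powr b)) = ennreal_power (N (\<lambda>x. ereal (g x))) b"
proof -
  have "enn2ereal (ennreal_power (e2ennreal \<bar>ereal (\<bar>g x\<bar> powr b)\<bar>) (1 / b)) = \<bar>ereal (g x)\<bar>" for x
  proof -
    have "e2ennreal \<bar>ereal (\<bar>g x\<bar> powr b)\<bar> = ennreal (\<bar>g x\<bar> powr b)"
      by simp
    then show ?thesis using b by (simp add: ennreal_power_ennreal powr_powr)
  qed
  moreover have B1: "\<forall>f\<in>L_class. N (\<lambda>x. \<bar>f x\<bar>) = N f"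
    using fsa unfolding function_space_axioms_def by (elim conjE)
  have "N (\<lambda>x. \<bar>ereal (g x)\<bar>) = N (\<lambda>x. ereal (g x))"
    by (rule B1[rule_format, OF L_class_ereal[OF g]])
  ultimately show ?thesis by (simp add: power_gauge_def)
qed

section \<open>Finite sums and averages under a norm\<close>

context
  fixes X :: "('n::finite) gauge"
  assumes BFS: "BFS X"
begin

lemma BFS_scale:
  assumes "u \<in> borel_measurable borel" "X (\<lambda>x. ereal (u x)) < \<infinity>"
  shows "X (\<lambda>x. ereal (c * u x)) = ennreal \<bar>c\<bar> * X (\<lambda>x. ereal (u x))"
proof -
  have "(\<lambda>x. ereal (u x)) \<in> carrier_of X" using assms by (auto simp: carrier_of_def)
  moreover have "\<forall>f\<in>carrier_of X. \<forall>c::real. X (\<lambda>x. ereal c * f x) = ennreal \<bar>c\<bar> * X f"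
    using BFS unfolding BFS_def is_norm_def quasi_norm_const_def by blast
  ultimately have "X (\<lambda>x. ereal c * ereal (u x)) = ennreal \<bar>c\<bar> * X (\<lambda>x. ereal (u x))"
    by (drule_tac bspec) auto
  then show ?thesis by simp
qed

text \<open>If either function lies outside the carrier, the right-hand side is infinite, so later
  estimates can add gauges without checking finiteness first.\<close>

lemma BFS_triangle:
  assumes "u \<in> borel_measurable borel" "v \<in> borel_measurable borel"
  shows "X (\<lambda>x. ereal (u x + v x)) \<le> X (\<lambda>x. ereal (u x)) + X (\<lambda>x. ereal (v x))"
proof (cases "X (\<lambda>x. ereal (u x)) < \<infinity> \<and> X (\<lambda>x. ereal (v x)) < \<infinity>")
  case True
  then have "(\<lambda>x. ereal (u x)) \<in> carrier_of X" "(\<lambda>x. ereal (v x)) \<in> carrier_of X"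
    using assms by (auto simp: carrier_of_def)
  moreover have "\<forall>f\<in>carrier_of X. \<forall>g\<in>carrier_of X. X (\<lambda>x. f x + g x) \<le> ennreal 1 * (X f + X g)"
    using BFS unfolding BFS_def is_norm_def quasi_norm_const_def by blast
  ultimately have "X (\<lambda>x. ereal (u x) + ereal (v x)) \<le>
    ennreal 1 * (X (\<lambda>x. ereal (u x)) + X (\<lambda>x. ereal (v x)))"
    by metis
  then show ?thesis by simp
next
  case False
  then show ?thesis by (auto simp: less_top[symmetric])
qed

lemma BFS_zero: "X (\<lambda>x. ereal 0) = 0"
proof -
  have "(\<lambda>x. ereal 0) \<in> L_class" by auto
  then show ?thesis using BFS unfolding BFS_def function_space_axioms_def by auto
qed

lemma BFS_sum:
  assumes "finite I" "\<And>i. i \<in> I \<Longrightarrow> u i \<in> borel_measurable borel"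
  shows "X (\<lambda>x. ereal (\<Sum>i\<in>I. u i x)) \<le> (\<Sum>i\<in>I. X (\<lambda>x. ereal (u i x)))"
  using assms
proof (induction I rule: finite_induct)
  case empty
  then show ?case using BFS_zero by (simp add: zero_ereal_def)
next
  case (insert i I)
  have "X (\<lambda>x. ereal (u i x + (\<Sum>i\<in>I. u i x))) \<le> X (\<lambda>x. ereal (u i x)) + X (\<lambda>x. ereal (\<Sum>i\<in>I. u i x))"
    using insert by (intro BFS_triangle) auto
  also have "\<dots> \<le> X (\<lambda>x. ereal (u i x)) + (\<Sum>i\<in>I. X (\<lambda>x. ereal (u i x)))"
    using insert by (intro add_left_mono) auto
  finally show ?case using insert by simp
qed

text \<open>A substitute for the integral Minkowski inequality: finite averages are controlled by the
  triangle inequality, and they converge almost everywhere along a suitable choice of samples.\<close>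

lemma BFS_Minkowski:
  fixes h :: "(real ^ 'n) \<times> (real ^ 'n) \<Rightarrow> real" and u :: "real ^ 'n \<Rightarrow> real"
  assumes U: "emeasure lborel U \<noteq> 0" "emeasure lborel U \<noteq> \<infinity>"
    and Q: "prob_space Q" and Q_sets: "sets Q = sets borel"
    and h_meas: "h \<in> borel_measurable borel" and h: "\<And>z. 0 \<le> h z" "\<And>z. h z \<le> 1"
    and u_meas: "u \<in> borel_measurable borel" and u: "\<And>x. 0 \<le> u x" "\<And>x. x \<notin> U \<Longrightarrow> u x = 0"
    and M: "AE y in Q. X (\<lambda>x. ereal (u x * h (x, y))) \<le> ennreal M" and "0 \<le> M"
    and c: "0 < c" "\<And>x. x \<in> U \<Longrightarrow> c \<le> (\<integral>y. h (x, y) \<partial>Q)"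
  shows "X (\<lambda>x. ereal (u x)) \<le> ennreal (M / c)"
proof -
  note [measurable] = h_meas u_meas
  have fsa: "function_space_axioms X" using BFS by (simp add: BFS_def)
  interpret Q: prob_space Q by fact
  \<comment> \<open>\<open>U\<close> has positive finite measure, so what holds
    \<open>P\<close>-almost everywhere holds at almost every point of \<open>U\<close>; this lets
    the sampling lemma speak about Lebesgue measure.\<close>
  define P where "P = uniform_measure lborel U"
  interpret P: prob_space P unfolding P_def by (rule prob_space_uniform_measure) (use U in auto)
  have [measurable_cong]: "sets P = sets borel" "sets Q = sets borel"
    using Q_sets by (auto simp: P_def)
  have PQ: "sets (P \<Otimes>\<^sub>M Q) = sets borel"
    by (subst borel_prod[symmetric]) (intro sets_pair_measure_cong, auto simp: P_def Q_sets)
  have hPQ: "h \<in> borel_measurable (P \<Otimes>\<^sub>M Q)"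
    using h_meas by (subst measurable_cong_sets[OF PQ refl])
  obtain y :: "nat \<Rightarrow> nat \<Rightarrow> real ^ 'n" and r :: "nat \<Rightarrow> nat"
    where y: "\<forall>k. \<forall>i<Suc (r k). X (\<lambda>x. ereal (u x * h (x, y k i))) \<le> ennreal M"
    and lim: "AE x in P. (\<lambda>k. (\<Sum>i<Suc (r k). h (x, y k i)) / real (Suc (r k)))
           \<longlonglongrightarrow> (\<integral>t. h (x, t) \<partial>Q)"
    by (rule sample_average_AE[OF P.prob_space_axioms Q hPQ h M]) (rule that)
  have [measurable]: "(\<lambda>x. h (x, t)) \<in> borel_measurable borel" for t
    by (rule measurable_compose[OF _ h_meas]) simp
  define v where "v k x = (\<Sum>i<Suc (r k). h (x, y k i)) / real (Suc (r k))" for k x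
  define hbar where "hbar x = (\<integral>t. h (x, t) \<partial>Q)" for x
  have [measurable]: "v k \<in> borel_measurable borel" for k unfolding v_def by measurable
  have "(\<lambda>x. \<integral>t. h (x, t) \<partial>Q) \<in> borel_measurable P"
    by (rule Q.borel_measurable_lebesgue_integral) (use hPQ in simp)
  then have [measurable]: "hbar \<in> borel_measurable borel"
    unfolding hbar_def by (simp add: P_def)
  \<comment> \<open>Each of the \<open>Suc (r k)\<close> summands has gauge at most
    \<open>M\<close>; the triangle inequality and homogeneity pass this bound to their
    average.\<close>
  have v: "X (\<lambda>x. ereal (u x * v k x)) \<le> ennreal M" for k
  proof -
    let ?S = "\<lambda>x. \<Sum>i<Suc (r k). u x * h (x, y k i)"
    have "X (\<lambda>x. ereal (?S x)) \<le> (\<Sum>i<Suc (r k). X (\<lambda>x. ereal (u x * h (x, y k i))))"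
      by (intro BFS_sum) auto
    also have "\<dots> \<le> (\<Sum>i<Suc (r k). ennreal M)"
      by (intro sum_mono y[rule_format]) simp
    also have "\<dots> = ennreal (real (Suc (r k)) * M)"
      using \<open>0 \<le> M\<close> by (simp add: ennreal_mult ennreal_of_nat_eq_real_of_nat[symmetric] del: of_nat_Suc sum.lessThan_Suc)
    finally have S: "X (\<lambda>x. ereal (?S x)) \<le> ennreal (real (Suc (r k)) * M)" .
    have "u x * v k x = inverse (real (Suc (r k))) * ?S x" for x
      by (simp add: v_def sum_distrib_left divide_inverse mult_ac del: of_nat_Suc sum.lessThan_Suc)
    then have "X (\<lambda>x. ereal (u x * v k x)) = X (\<lambda>x. ereal (inverse (real (Suc (r k))) * ?S x))"
      by presburger
    also have "\<dots> = ennreal \<bar>inverse (real (Suc (r k)))\<bar> * X (\<lambda>x. ereal (?S x))"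
      using S by (intro BFS_scale) (auto simp: le_less_trans simp del: of_nat_Suc sum.lessThan_Suc)
    also have "\<dots> \<le> ennreal \<bar>inverse (real (Suc (r k)))\<bar> * ennreal (real (Suc (r k)) * M)"
      by (intro mult_left_mono S) simp
    also have "\<dots> = ennreal M"
      using \<open>0 \<le> M\<close> by (simp add: ennreal_mult[symmetric] del: of_nat_Suc)
    finally show ?thesis .
  qed
  have "AE x in lborel. x \<in> U \<longrightarrow> (\<lambda>k. v k x) \<longlonglongrightarrow> hbar x"
    using lim U unfolding P_def v_def hbar_def by (subst (asm) AE_uniform_measure) (auto simp: less_top)
  then have "AE x in lebesgue. x \<in> U \<longrightarrow> (\<lambda>k. v k x) \<longlonglongrightarrow> hbar x"
    by (rule AE_completion)
  \<comment> \<open>Off \<open>U\<close> the factor \<open>u\<close> vanishes, so convergence of the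
    averages on \<open>U\<close> is enough for the products.\<close>
  then have "AE x in lebesgue. (\<lambda>k. ereal (u x * v k x)) \<longlonglongrightarrow> ereal (u x * hbar x)"
  proof eventually_elim
    case (elim x)
    then show ?case by (cases "x \<in> U") (auto simp: u intro!: tendsto_intros)
  qed
  then have 1: "X (\<lambda>x. ereal (u x * hbar x)) \<le> ennreal M"
    by (rule gauge_Fatou[OF fsa, rotated 3])
       (use v in \<open>auto simp: u h v_def intro!: mult_nonneg_nonneg divide_nonneg_nonneg sum_nonneg simp del: of_nat_Suc sum.lessThan_Suc\<close>)
  \<comment> \<open>On \<open>U\<close> the mean \<open>hbar\<close> is at least \<open>c\<close>,
    so \<open>u\<close> is at most \<open>u * hbar / c\<close>; off \<open>U\<close> both sides
    vanish.\<close>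
  have "X (\<lambda>x. ereal (u x)) \<le> X (\<lambda>x. ereal ((1 / c) * (u x * hbar x)))"
  proof (rule gauge_mono[OF fsa])
    show "AE x in lebesgue. \<bar>ereal (u x)\<bar> \<le> \<bar>ereal (1 / c * (u x * hbar x))\<bar>"
    proof (rule AE_I2)
      fix x
      show "\<bar>ereal (u x)\<bar> \<le> \<bar>ereal (1 / c * (u x * hbar x))\<bar>"
      proof (cases "x \<in> U")
        case True
        with c have "c \<le> hbar x" by (simp add: hbar_def)
        with c(1) have "1 \<le> hbar x / c" by simp
        then have "u x * 1 \<le> u x * (hbar x / c)" by (intro mult_left_mono u(1))
        also have "u x * (hbar x / c) = 1 / c * (u x * hbar x)" by simp
        finally show ?thesis using u(1)[of x] abs_ge_self[of "1 / c * (u x * hbar x)"]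
          by (simp only: abs_ereal.simps ereal_less_eq)
      next
        case False
        then show ?thesis using u(2)[of x] by simp
      qed
    qed
  qed (intro L_class_ereal; measurable)+
  also have "\<dots> = ennreal (1 / c) * X (\<lambda>x. ereal (u x * hbar x))"
    using le_less_trans[OF 1] c(1) by (subst BFS_scale) simp_all
  also have "\<dots> \<le> ennreal (1 / c) * ennreal M"
    by (intro mult_left_mono 1) simp
  also have "\<dots> = ennreal (M / c)"
    using c(1) \<open>0 \<le> M\<close> by (simp add: ennreal_mult[symmetric])
  finally show ?thesis .
qed

end

subsection \<open>Approximation by step functions on cubes\<close>

text \<open>Dividing by \<open>\<bar>x\<bar> + \<bar>y\<bar>\<close> gives two ratios in [0,1] with
  sum 1, and raising a number in [0,1] to a power \<open>b \<le> 1\<close> does not decrease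
  it.\<close>

lemma powr_subadd:
  fixes x y b :: real
  assumes "0 < b" "b \<le> 1"
  shows "\<bar>x + y\<bar> powr b \<le> \<bar>x\<bar> powr b + \<bar>y\<bar> powr b"
proof (cases "x = 0 \<and> y = 0")
  case True
  then show ?thesis by simp
next
  case False
  define z where "z = \<bar>x\<bar> + \<bar>y\<bar>"
  have z: "0 < z" using False by (auto simp: z_def)
  have *: "\<bar>w\<bar> / z \<le> (\<bar>w\<bar> / z) powr b" if "\<bar>w\<bar> \<le> z" for w
    using powr_mono'[of b 1 "\<bar>w\<bar> / z"] that z assms by simp
  have "1 = \<bar>x\<bar> / z + \<bar>y\<bar> / z"
    using z by (simp add: z_def add_divide_distrib[symmetric])
  also have "\<dots> \<le> (\<bar>x\<bar> / z) powr b + (\<bar>y\<bar> / z) powr b"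
    by (intro add_mono *) (auto simp: z_def)
  also have "\<dots> = (\<bar>x\<bar> powr b + \<bar>y\<bar> powr b) / z powr b"
    using z by (simp add: powr_divide add_divide_distrib)
  finally have "z powr b \<le> \<bar>x\<bar> powr b + \<bar>y\<bar> powr b"
    using z by (simp add: field_simps)
  moreover have "\<bar>x + y\<bar> powr b \<le> z powr b"
    using assms by (intro powr_mono2) (auto simp: z_def)
  ultimately show ?thesis by linarith
qed

text \<open>The net consists of multiples of \<open>e\<close>; rounding \<open>m\<close> down to the
  nearest multiple moves it by less than \<open>e\<close>. It discretises the values of the step
  functions.\<close>

lemma finite_net_interval:
  fixes L e :: real
  assumes e: "0 < e"
  shows "\<exists>D. finite D \<and> (\<forall>m. \<bar>m\<bar> \<le> L \<longrightarrow> (\<exists>d\<in>D. \<bar>m - d\<bar> < e))"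
proof (intro exI[of _ "(\<lambda>i. of_int i * e) ` {- \<lceil>L / e\<rceil> - 1..\<lceil>L / e\<rceil>}"] conjI allI impI)
  fix m :: real assume m: "\<bar>m\<bar> \<le> L"
  then have "\<bar>m / e\<bar> \<le> L / e" using e by (simp add: abs_divide divide_right_mono)
  then have "\<lfloor>m / e\<rfloor> \<in> {- \<lceil>L / e\<rceil> - 1..\<lceil>L / e\<rceil>}" unfolding atLeastAtMost_iff by linarith
  moreover have "\<bar>m - of_int \<lfloor>m / e\<rfloor> * e\<bar> < e"
  proof -
    have "of_int \<lfloor>m / e\<rfloor> * e \<le> m" "m < (of_int \<lfloor>m / e\<rfloor> + 1) * e"
      using e by (simp_all add: pos_le_divide_eq[symmetric] pos_divide_less_eq[symmetric])
    then show ?thesis by (simp add: algebra_simps)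
  qed
  ultimately show "\<exists>d\<in>(\<lambda>i. of_int i * e) ` {- \<lceil>L / e\<rceil> - 1..\<lceil>L / e\<rceil>}. \<bar>m - d\<bar> < e" by blast
qed simp

lemma distr_lborel_reflect:
  fixes x :: "'a::euclidean_space"
  shows "distr lborel borel (\<lambda>y. x - y) = lborel"
  using lborel_affine[of "-1" x] by (simp add: density_1)

text \<open>Translates of null sets are null, so one representative of \<open>f\<close> serves for
  its translates as well.\<close>

lemma AE_lborel_translate:
  fixes y :: "'a::euclidean_space"
  assumes "AE x in lborel. P x"
  shows "AE x in lborel. P (x - y)"
proof -
  have "AE x in distr lborel borel ((+) (- y)). P x" using assms by (subst lborel_distr_plus)
  from AE_distrD[OF _ this] show ?thesis by simp
qed

section \<open>The grid of half-open cubes\<close>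

definition cell :: "real \<Rightarrow> real ^ 'n \<Rightarrow> 'n::finite \<Rightarrow> int" where
  "cell s x = (\<lambda>i. \<lfloor>x $ i / s\<rfloor>)"

text \<open>As fibres of \<open>cell s\<close> the cubes are disjoint and cover the whole space,
  with no exceptional boundary points.\<close>

definition cube :: "real \<Rightarrow> ('n::finite \<Rightarrow> int) \<Rightarrow> (real ^ 'n) set" where
  "cube s k = {x. cell s x = k}"

definition step :: "real \<Rightarrow> ('n::finite \<Rightarrow> int) set \<Rightarrow> (('n \<Rightarrow> int) \<Rightarrow> real) \<Rightarrow> real ^ 'n \<Rightarrow> real" where
  "step s J m x = (\<Sum>k\<in>J. m k * indicator (cube s k) x)"

lemma mem_cube: "x \<in> cube s k \<longleftrightarrow> cell s x = k"
  by (simp add: cube_def)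

lemma cube_iff:
  assumes "0 < s"
  shows "x \<in> cube s k \<longleftrightarrow> (\<forall>i. s * of_int (k i) \<le> x $ i \<and> x $ i < s * of_int (k i) + s)"
  using assms unfolding mem_cube cell_def fun_eq_iff floor_eq_iff by (simp add: field_simps)

lemma cube_borel [measurable]: "cube s k \<in> sets borel"
proof -
  have "cube s k = {x \<in> space borel. \<forall>i. \<lfloor>x $ i / s\<rfloor> = k i}" by (auto simp: cube_def cell_def)
  then show ?thesis by simp
qed

text \<open>Two points of one cube are joined by a translation from a box of side
  \<open>2 * s\<close>; over this box the translations are averaged below.\<close>

lemma cube_diff:
  assumes "0 < s" "x \<in> cube s k" "t \<in> cube s k"
  shows "x - t \<in> cbox (- (\<chi> i. s)) (\<chi> i. s)"
proof -
  have "- s \<le> x $ i - t $ i \<and> x $ i - t $ i \<le> s" for i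
    using assms(2,3) unfolding cube_iff[OF assms(1)] by (smt (verit))
  then show ?thesis by (simp add: mem_box_cart)
qed

lemma cube_subset_cbox:
  fixes k :: "'n::finite \<Rightarrow> int"
  assumes "0 < s"
  shows "cube s k \<subseteq> cbox (\<chi> i. s * of_int (k i)) (\<chi> i. s * of_int (k i) + s)"
  using assms by (auto simp: mem_box_cart cube_iff less_imp_le)

lemma bounded_cube: "0 < s \<Longrightarrow> bounded (cube s k)"
  using cube_subset_cbox bounded_subset bounded_cbox by metis

lemma emeasure_cube_finite: "0 < s \<Longrightarrow> emeasure lborel (cube s k) < \<infinity>"
  by (rule emeasure_bounded_finite[OF bounded_cube])

lemma measure_cube_ge:
  fixes k :: "'n::finite \<Rightarrow> int"
  assumes "0 < s"
  shows "s ^ CARD('n) \<le> measure lborel (cube s k)"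
proof -
  let ?a = "\<chi> i. s * of_int (k i) :: real ^ 'n" and ?b = "\<chi> i. s * of_int (k i) + s :: real ^ 'n"
  have ne: "cbox ?a ?b \<noteq> {}" using assms by (auto simp: interval_ne_empty_cart)
  have "s ^ CARD('n) = measure lborel (cbox ?a ?b)"
    using content_cbox_cart[OF ne] by simp
  \<comment> \<open>Passing to the open box costs no measure and puts it inside the half-open
    cube.\<close>
  also have "\<dots> = measure lborel (box ?a ?b)"
    by (simp add: measure_lborel_box_eq measure_lborel_cbox_eq)
  also have "\<dots> \<le> measure lborel (cube s k)"
    using assms emeasure_cube_finite[OF assms, of k]
    by (intro measure_mono_fmeasurable) (auto simp: mem_box_cart cube_iff fmeasurable_def less_imp_le)
  finally show ?thesis .
qed

lemma measure_cube_pos: "0 < s \<Longrightarrow> 0 < measure lborel (cube s k)"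
  using measure_cube_ge[of s k] by (meson less_le_trans zero_less_power)

lemma step_borel [measurable]: "step s J m \<in> borel_measurable borel"
  unfolding step_def by measurable

lemma step_eq:
  assumes "finite J"
  shows "step s J m x = (if cell s x \<in> J then m (cell s x) else 0)"
proof -
  have "step s J m x = (\<Sum>k\<in>J. if cell s x = k then m k else 0)"
    unfolding step_def by (intro sum.cong) (auto simp: mem_cube)
  with assms show ?thesis by simp
qed

text \<open>At each point at most one summand is nonzero, so the power passes inside the sum, where
  the triangle inequality applies.\<close>

lemma step_powr:
  assumes "finite J"
  shows "\<bar>step s J m x\<bar> powr b = (\<Sum>k\<in>J. \<bar>m k\<bar> powr b * indicator (cube s k) x)"
  using assms step_eq[OF assms, of s m x] step_eq[OF assms, of s "\<lambda>k. \<bar>m k\<bar> powr b" x]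
  by (simp add: step_def)

lemma step_diff: "step s J m x - step s J d x = step s J (\<lambda>k. m k - d k) x"
  by (simp add: step_def sum_subtractf left_diff_distrib)

text \<open>Medians rather than means, since \<open>f\<close> need not be locally integrable.\<close>

lemma BFS_median_approximation:
  fixes X :: "('n::finite) gauge" and f :: "real ^ 'n \<Rightarrow> real"
  assumes BFS: "BFS X" and b: "0 < b" and f [measurable]: "f \<in> borel_measurable borel"
    and s: "0 < s" and J: "finite J" "J \<noteq> {}" and M: "0 \<le> M"
    and osc: "\<And>y. y \<in> cbox (- (\<chi> i. s)) (\<chi> i. s) \<Longrightarrow>
      X (\<lambda>x. ereal (\<bar>f (x - y) - f x\<bar> powr b)) \<le> ennreal M"
  shows "\<exists>m. X (\<lambda>x. ereal (\<bar>f x - step s J m x\<bar> powr b * indicator (\<Union>k\<in>J. cube s k) x))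
    \<le> ennreal (2 ^ (CARD('n) + 1) * M)"
proof -
  have fsa: "function_space_axioms X" using BFS by (simp add: BFS_def)
  define Y :: "(real ^ 'n) set" where "Y = cbox (- (\<chi> i. s)) (\<chi> i. s)"
  define Q where "Q = uniform_measure lborel Y"
  define U where "U = (\<Union>k\<in>J. cube s k)"
  have cube_nz: "emeasure lborel (cube s k) \<noteq> 0" for k :: "'n \<Rightarrow> int"
    using measure_cube_pos[OF s, of k] by (metis measure_eq_emeasure_eq_ennreal ennreal_0 less_irrefl measure_def enn2real_0)
  \<comment> \<open>\<open>m k\<close> will be a median of \<open>f\<close> for the uniform
    distribution on the cube.\<close>
  have "\<exists>a. measure lborel (cube s k) / 2 \<le> measure lborel (cube s k \<inter> {t. f t \<le> a}) \<and>
      measure lborel (cube s k) / 2 \<le> measure lborel (cube s k \<inter> {t. a \<le> f t})" for k :: "'n \<Rightarrow> int"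
  proof -
    let ?C = "uniform_measure lborel (cube s k)"
    have fin: "emeasure lborel (cube s k) \<noteq> \<infinity>" using emeasure_cube_finite[OF s, of k] by simp
    interpret C: prob_space ?C by (rule prob_space_uniform_measure[OF cube_nz fin])
    obtain a where "1 / 2 \<le> measure ?C {t \<in> space ?C. f t \<le> a}" "1 / 2 \<le> measure ?C {t \<in> space ?C. a \<le> f t}"
      using C.median_exists[of f] by auto
    with measure_cube_pos[OF s, of k] show ?thesis
      by (intro exI[of _ a]) (simp add: measure_uniform_measure[OF cube_nz fin] field_simps)
  qed
  then obtain m where m: "\<And>k. measure lborel (cube s k) / 2 \<le> measure lborel (cube s k \<inter> {t. f t \<le> m k})"
      "\<And>k. measure lborel (cube s k) / 2 \<le> measure lborel (cube s k \<inter> {t. m k \<le> f t})" by metis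
  define g where "g = step s J m"
  have [measurable]: "g \<in> borel_measurable borel" by (simp add: g_def)
  have [measurable]: "U \<in> sets borel" unfolding U_def using J by auto
  have Y_ne: "Y \<noteq> {}" unfolding Y_def using s by (auto simp: interval_ne_empty_cart)
  have Y_measure: "measure lborel Y = (2 * s) ^ CARD('n)"
    using content_cbox_cart[OF Y_ne[unfolded Y_def]] by (simp add: Y_def)
  have Y_fin: "emeasure lborel Y \<noteq> \<infinity>"
    using emeasure_bounded_finite[of Y] by (simp add: Y_def)
  have "0 < measure lborel Y" using s by (simp add: Y_measure)
  then have Y_nz: "emeasure lborel Y \<noteq> 0" by (metis measure_def enn2real_0 less_irrefl)
  have [measurable]: "Y \<in> sets borel" by (simp add: Y_def)
  \<comment> \<open>\<open>h\<close> marks the pairs \<open>(x, y)\<close> for which the difference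
    of \<open>f\<close> along the translation \<open>y\<close> dominates the distance of
    \<open>f x\<close> from the median.\<close>
  define h where "h z = (if \<bar>f (fst z) - g (fst z)\<bar> \<le> \<bar>f (fst z) - f (fst z - snd z)\<bar> then 1 else 0 :: real)" for z
  define u where "u x = \<bar>f x - g x\<bar> powr b * indicator U x" for x
  have [measurable]: "u \<in> borel_measurable borel" unfolding u_def by measurable
  have h_meas: "h \<in> borel_measurable borel"
  proof -
    have "h \<in> borel_measurable (borel \<Otimes>\<^sub>M borel)" unfolding h_def by measurable
    then show ?thesis by (simp add: borel_prod)
  qed
  have "X (\<lambda>x. ereal (u x)) \<le> ennreal (M / (1 / 2 ^ (CARD('n) + 1)))"
  proof (rule BFS_Minkowski[OF BFS, where U=U and Q=Q and h=h])
    have "bounded U" unfolding U_def using J(1) bounded_cube[OF s] by auto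
    then show "emeasure lborel U \<noteq> \<infinity>" using emeasure_bounded_finite less_irrefl by fastforce
    obtain k where "k \<in> J" using J by auto
    then have "emeasure lborel (cube s k) \<le> emeasure lborel U"
      by (intro emeasure_mono) (auto simp: U_def)
    then show "emeasure lborel U \<noteq> 0" using cube_nz[of k] by auto
    show "prob_space Q" unfolding Q_def by (rule prob_space_uniform_measure[OF Y_nz Y_fin])
    show "sets Q = sets borel" by (simp add: Q_def)
    show "AE y in Q. X (\<lambda>x. ereal (u x * h (x, y))) \<le> ennreal M"
      unfolding Q_def
    proof (rule AE_uniform_measureI)
      show "AE y in lborel. y \<in> Y \<longrightarrow> X (\<lambda>x. ereal (u x * h (x, y))) \<le> ennreal M"
      proof (intro AE_I2 impI)
        fix y assume y: "y \<in> Y"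
        \<comment> \<open>Where \<open>h\<close> is 1 the oscillation dominates \<open>u\<close>,
          and elsewhere the product is 0; hence \<open>osc\<close> bounds its gauge.\<close>
        have "(\<lambda>x. h (x, y)) \<in> borel_measurable borel"
          by (rule measurable_compose[OF _ h_meas]) simp
        then have "X (\<lambda>x. ereal (u x * h (x, y))) \<le> X (\<lambda>x. ereal (\<bar>f (x - y) - f x\<bar> powr b))"
          using b by (intro gauge_mono[OF fsa] L_class_ereal AE_I2)
            (auto simp: u_def h_def indicator_def abs_minus_commute intro!: powr_mono2)
        with osc[OF y[unfolded Y_def]] show "X (\<lambda>x. ereal (u x * h (x, y))) \<le> ennreal M"
          by (rule order_trans[rotated])
      qed
    qed simp
    fix x assume "x \<in> U"
    then obtain k where k: "k \<in> J" "x \<in> cube s k" by (auto simp: U_def)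
    then have gx: "g x = m k" by (simp add: g_def step_eq[OF J(1)] mem_cube)
    \<comment> \<open>\<open>S\<close> is the part of the cube where \<open>f\<close> lies on the
      other side of the median from \<open>f x\<close>. For \<open>t\<close> in \<open>S\<close> the
      median lies between \<open>f t\<close> and \<open>f x\<close>, and \<open>S\<close> fills at
      least half of the cube.\<close>
    define S where "S = cube s k \<inter> (if m k \<le> f x then {t. f t \<le> m k} else {t. m k \<le> f t})"
    have [measurable]: "S \<in> sets borel" unfolding S_def by simp
    define W where "W = {y. h (x, y) = 1}"
    have "(\<lambda>y. h (x, y)) \<in> borel_measurable borel"
      by (rule measurable_compose[OF _ h_meas]) simp
    then have [measurable]: "W \<in> sets borel" unfolding W_def by measurable
    have "s ^ CARD('n) / 2 \<le> measure lborel S"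
      using m[of k] measure_cube_ge[OF s, of k] by (auto simp: S_def)
    \<comment> \<open>The substitution \<open>y = x - t\<close> preserves Lebesgue measure and sends
      \<open>S\<close> into the marked translations in \<open>Y\<close>.\<close>
    also have "\<dots> = measure (distr lborel borel (\<lambda>y. x - y)) S" by (simp add: distr_lborel_reflect)
    also have "\<dots> = measure lborel {y. x - y \<in> S}"
      by (subst measure_distr) (auto simp: vimage_def)
    also have "\<dots> \<le> measure lborel (Y \<inter> W)"
    proof (rule measure_mono_fmeasurable)
      show "{y. x - y \<in> S} \<subseteq> Y \<inter> W"
      proof (rule subsetI)
        fix y assume "y \<in> {y. x - y \<in> S}"
        then have y: "x - y \<in> S" by simp
        then have "x - (x - y) \<in> Y"
          unfolding Y_def by (intro cube_diff[OF s k(2)]) (simp add: S_def)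
        moreover have "h (x, y) = 1" using y by (auto simp: h_def gx S_def split: if_splits)
        ultimately show "y \<in> Y \<inter> W" by (simp add: W_def)
      qed
      show "{y. x - y \<in> S} \<in> sets lborel"
        using measurable_sets_borel[of "\<lambda>y. x - y" borel S] by (simp add: vimage_def)
      show "Y \<inter> W \<in> fmeasurable lborel"
        using Y_fin by (intro fmeasurable_Int_fmeasurable) (auto simp: fmeasurable_def less_top)
    qed
    finally have ge: "s ^ CARD('n) / 2 \<le> measure lborel (Y \<inter> W)" .
    have "(\<integral>y. h (x, y) \<partial>Q) = (\<integral>y. indicator W y \<partial>Q)"
      by (intro Bochner_Integration.integral_cong) (auto simp: W_def h_def)
    also have "\<dots> = measure Q W" by (simp add: Q_def)
    also have "\<dots> = measure lborel (Y \<inter> W) / (2 * s) ^ CARD('n)"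
      unfolding Q_def by (subst measure_uniform_measure[OF Y_nz Y_fin]) (auto simp: Y_measure)
    \<comment> \<open>The box \<open>Y\<close> has twice the side of the cube, which costs a factor
      2 per dimension; the median costs one more.\<close>
    also have "\<dots> \<ge> (s ^ CARD('n) / 2) / (2 * s) ^ CARD('n)"
      using ge s by (intro divide_right_mono) auto
    also have "(s ^ CARD('n) / 2) / (2 * s) ^ CARD('n) = 1 / 2 ^ (CARD('n) + 1)"
      using s by (simp add: power_mult_distrib)
    finally show "1 / 2 ^ (CARD('n) + 1) \<le> (\<integral>y. h (x, y) \<partial>Q)" .
  qed (use h_meas M in \<open>auto simp: h_def u_def\<close>)
  then show ?thesis unfolding u_def g_def U_def by (auto simp: mult.commute)
qed

subsection \<open>Total boundedness\<close>

lemma ennreal_power_measurable [measurable]: "(\<lambda>x. ennreal_power x p) \<in> borel_measurable borel"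
  unfolding ennreal_power_def by measurable

lemma L_class_translate:
  assumes "f \<in> L_class"
  shows "translate y f \<in> L_class"
proof -
  have "(\<lambda>x. - y + (\<Sum>j\<in>Basis. (1 * (x \<bullet> j)) *\<^sub>R j)) \<in> lebesgue \<rightarrow>\<^sub>M lebesgue"
    by (rule lebesgue_affine_measurable) simp
  then have "(\<lambda>x. x - y) \<in> lebesgue \<rightarrow>\<^sub>M lebesgue" by (simp add: euclidean_representation)
  from measurable_compose[OF this] show ?thesis
    using assms by (simp add: L_class_def translate_def)
qed

text \<open>Finiteness almost everywhere comes from the power space: \<open>F\<close>, the
  \<open>b\<close>-th power of \<open>\<bar>f\<bar>\<close>, has finite power gauge and so lies in
  \<open>L0_class\<close>. A Borel representative keeps translations and functions on the product
  measurable.\<close>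

lemma borel_representative:
  assumes fsa: "function_space_axioms N" and b: "0 < b"
    and L0: "carrier_of (power_gauge b N) \<subseteq> L0_class"
    and f: "f \<in> carrier_of N"
  shows "\<exists>g \<in> borel_measurable borel. AE x in lebesgue. f x = ereal (g x)"
proof -
  have fL: "f \<in> L_class" and Nf: "N f < \<infinity>" using f by (auto simp: carrier_of_def)
  have [measurable]: "f \<in> borel_measurable lebesgue" using fL by (simp add: L_class_def)
  define F where "F x = enn2ereal (ennreal_power (e2ennreal \<bar>f x\<bar>) b)" for x
  have inv: "enn2ereal (ennreal_power (e2ennreal \<bar>F x\<bar>) (1 / b)) = \<bar>f x\<bar>" for x
  proof (cases "\<bar>f x\<bar>")
    case (real r)
    then have "0 \<le> r" using abs_ereal_ge0 by (metis abs_ereal_pos ereal_less_eq(5))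
    with real b show ?thesis by (simp add: F_def ennreal_power_ennreal powr_powr)
  next
    case PInf
    then show ?thesis using b by (simp add: F_def ennreal_power_def)
  next
    case MInf
    then show ?thesis using abs_ereal_pos[of "f x"] by simp
  qed
  have F: "F \<in> L_class" unfolding F_def L_class_def by measurable
  have B1: "\<forall>f\<in>L_class. N (\<lambda>x. \<bar>f x\<bar>) = N f"
    using fsa unfolding function_space_axioms_def by (elim conjE)
  have "power_gauge b N F = ennreal_power (N f) b"
    using B1 fL unfolding power_gauge_def inv by simp
  then have "F \<in> carrier_of (power_gauge b N)"
    using F ennreal_power_less_top[OF Nf] by (simp add: carrier_of_def)
  then have "AE x in lebesgue. \<bar>F x\<bar> \<noteq> \<infinity>" using L0 by (auto simp: L0_class_def)
  then have fin: "AE x in lebesgue. \<bar>f x\<bar> \<noteq> \<infinity>"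
  proof eventually_elim
    case (elim x)
    then show ?case by (auto simp: F_def ennreal_power_def)
  qed
  have "(\<lambda>x. real_of_ereal (f x)) \<in> borel_measurable lebesgue" by measurable
  then obtain g where "g \<in> borel_measurable lborel" "AE x in lborel. real_of_ereal (f x) = g x"
    using completion_ex_borel_measurable_real by blast
  moreover from this(2) have "AE x in lebesgue. real_of_ereal (f x) = g x" by (rule AE_completion)
  then have "AE x in lebesgue. f x = ereal (g x)"
    using fin by eventually_elim (auto simp: ereal_real)
  ultimately show ?thesis by auto
qed

lemma cell_bounded:
  assumes "0 < s" "norm x < R"
  shows "cell s x \<in> PiE UNIV (\<lambda>_. {- \<lceil>R / s\<rceil>..\<lceil>R / s\<rceil>})"
proof -
  have "- \<lceil>R / s\<rceil> \<le> \<lfloor>x $ i / s\<rfloor> \<and> \<lfloor>x $ i / s\<rfloor> \<le> \<lceil>R / s\<rceil>" for i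
  proof -
    have "\<bar>x $ i\<bar> \<le> R" using component_le_norm_cart[of x i] assms by linarith
    then have "\<bar>x $ i / s\<bar> \<le> R / s" using assms by (simp add: abs_divide divide_right_mono)
    then show ?thesis by linarith
  qed
  then show ?thesis by (auto simp: cell_def)
qed

theorem theorem3p6:
  fixes N :: "(real ^ 'n::finite \<Rightarrow> ereal) \<Rightarrow> ennreal"
    and \<F> :: "(real ^ 'n \<Rightarrow> ereal) set"
  assumes "power_QBFS N"
    and "absolutely_continuous_gauge N"
    and "\<F> \<subseteq> carrier_of N"
    and bounded: "(SUP f\<in>\<F>. N f) < \<infinity>"
    and vanishing: "((\<lambda>R::real. SUP f\<in>\<F>. N (restrict_fn (- ball 0 R) f)) \<longlongrightarrow> 0) at_top"
    and equicontinuous: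
      "((\<lambda>r::real. SUP f\<in>\<F>. SUP y\<in>ball 0 r. N (\<lambda>x. translate y f x - f x)) \<longlongrightarrow> 0) (at_right 0)"
  shows "totally_bounded_in N \<F>"
  unfolding totally_bounded_in_def
proof (intro conjI assms(3) allI impI)
  fix \<epsilon> :: real assume \<epsilon>: "0 < \<epsilon>"
  obtain b where b: "0 < b" "b \<le> 1" and L0: "carrier_of (power_gauge b N) \<subseteq> L0_class"
    and BFS: "BFS (power_gauge b N)" using assms(1) by (auto simp: power_QBFS_def)
  have N: "function_space_axioms N" using assms(1) by (simp add: power_QBFS_def QBFS_def)
  define X where "X = power_gauge b N"
  have BFS: "BFS X" using BFS by (simp add: X_def)
  then have X: "function_space_axioms X" by (simp add: BFS_def)
  have X_powr: "X (\<lambda>x. ereal (\<bar>g x\<bar> powr b)) = ennreal_power (N (\<lambda>x. ereal (g x))) b"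
    if "g \<in> borel_measurable borel" for g
    unfolding X_def by (rule power_gauge_powr[OF N b(1) that])
  have X_powr_le: "X (\<lambda>x. ereal (\<bar>g x\<bar> powr b)) \<le> ennreal c"
    if "g \<in> borel_measurable borel" "N (\<lambda>x. ereal (g x)) \<le> ennreal (c powr (1 / b))" "0 \<le> c" for g c
    using ennreal_power_mono[OF b(1) that(2)] that(1,3) b(1)
    by (simp add: X_powr ennreal_power_ennreal powr_powr)

  \<comment> \<open>Three errors of size \<open>a\<close> in \<open>X\<close> will be added, and
    \<open>3 * a\<close> is strictly below \<open>\<epsilon> powr b\<close>.\<close>
  define a where "a = \<epsilon> powr b / 4"
  have a: "0 < a" using \<epsilon> by (simp add: a_def)
  \<comment> \<open>\<open>C\<close> is the loss in \<open>BFS_median_approximation\<close>; an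
    oscillation of at most \<open>a / C\<close> makes the approximation error at most
    \<open>a\<close>.\<close>
  define C :: real where "C = 2 ^ (CARD('n) + 1)"
  have C: "0 < C" by (simp add: C_def)
  have root: "0 < c powr (1 / b)" if "0 < c" for c :: real using that by simp

  \<comment> \<open>Thresholds for \<open>N\<close> carry the exponent \<open>1 / b\<close> because
    \<open>X_powr_le\<close> turns them into the bounds \<open>a\<close> and \<open>a / C\<close>
    for \<open>X\<close>.\<close>
  have "eventually (\<lambda>R. (SUP f\<in>\<F>. N (restrict_fn (- ball 0 R) f)) < ennreal (a powr (1 / b))) at_top"
    using root[OF a] by (intro order_tendstoD(2)[OF vanishing]) simp
  from eventually_happens'[OF _ this]
  obtain R where R: "(SUP f\<in>\<F>. N (restrict_fn (- ball 0 R) f)) < ennreal (a powr (1 / b))"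
    by auto
  have "eventually (\<lambda>r. (SUP f\<in>\<F>. SUP y\<in>ball 0 r. N (\<lambda>x. translate y f x - f x))
      < ennreal ((a / C) powr (1 / b))) (at_right 0)"
    using root[of "a / C"] a C by (intro order_tendstoD(2)[OF equicontinuous]) simp
  then have "eventually (\<lambda>r. 0 < r \<and> (SUP f\<in>\<F>. SUP y\<in>ball 0 r. N (\<lambda>x. translate y f x - f x))
      < ennreal ((a / C) powr (1 / b))) (at_right 0)"
    using eventually_at_right_less by eventually_elim auto
  from eventually_happens'[OF _ this]
  obtain r where r: "0 < r" "(SUP f\<in>\<F>. SUP y\<in>ball 0 r. N (\<lambda>x. translate y f x - f x))
      < ennreal ((a / C) powr (1 / b))"
    by auto
  obtain B where B: "0 \<le> B" "(SUP f\<in>\<F>. N f) = ennreal B"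
    using bounded by (cases "SUP f\<in>\<F>. N f") auto

  \<comment> \<open>The l1 bound on the norm gives at most \<open>CARD('n) * s = r / 2\<close> on
    the box, so it fits into the ball of radius \<open>r\<close>.\<close>
  define s where "s = r / (2 * real CARD('n))"
  have s: "0 < s" using r by (simp add: s_def)
  have small: "cbox (- (\<chi> i. s)) (\<chi> i. s) \<subseteq> ball (0 :: real ^ 'n) r"
  proof
    fix y :: "real ^ 'n" assume "y \<in> cbox (- (\<chi> i. s)) (\<chi> i. s)"
    then have y: "- s \<le> y $ i \<and> y $ i \<le> s" for i by (auto simp: mem_box_cart)
    have "\<bar>y $ i\<bar> \<le> s" for i using y[of i] by (simp add: abs_le_iff)
    then have "(\<Sum>i\<in>UNIV. \<bar>y $ i\<bar>) \<le> (\<Sum>i\<in>(UNIV :: 'n set). s)" by (rule sum_mono)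
    with norm_le_l1_cart[of y] have "norm y \<le> real CARD('n) * s" by simp
    also have "\<dots> < r" using r by (simp add: s_def)
    finally show "y \<in> ball 0 r" by simp
  qed

  \<comment> \<open>\<open>J\<close> indexes finitely many cubes covering \<open>ball 0 R\<close>.
    The absolute value keeps \<open>J\<close> nonempty even if \<open>R\<close> is negative.\<close>
  define J :: "('n \<Rightarrow> int) set" where "J = PiE UNIV (\<lambda>_. {- \<lceil>\<bar>R\<bar> / s\<rceil>..\<lceil>\<bar>R\<bar> / s\<rceil>})"
  have J: "finite J" unfolding J_def by (intro finite_PiE) auto
  have "0 \<le> \<bar>R\<bar> / s" using s by simp
  then have "0 \<le> \<lceil>\<bar>R\<bar> / s\<rceil>" by linarith
  then have J_ne: "J \<noteq> {}" by (auto simp: J_def PiE_eq_empty_iff)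
  have outside: "x \<notin> ball 0 R" if "cell s x \<notin> J" for x :: "real ^ 'n"
  proof
    assume "x \<in> ball 0 R"
    then have "norm x < \<bar>R\<bar>" by simp
    from cell_bounded[OF s this] that show False by (simp add: J_def)
  qed
  define U where "U = (\<Union>k\<in>J. cube s k)"
  have U: "x \<in> U \<longleftrightarrow> cell s x \<in> J" for x by (auto simp: U_def mem_cube)
  have [measurable]: "U \<in> sets borel" unfolding U_def using J by auto

  \<comment> \<open>The gauge of a cube is finite by (B4) and nonzero by (B0), so one may divide by
    it.\<close>
  have "\<exists>q>0. X (\<lambda>x. ereal (indicator (cube s k) x)) = ennreal q" for k :: "'n \<Rightarrow> int"
  proof -
    have B4: "\<forall>A. bounded A \<and> A \<in> sets lebesgue \<longrightarrow> indicator A \<in> carrier_of X"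
      using X unfolding function_space_axioms_def by (elim conjE)
    have B0: "\<forall>f\<in>L_class. X f = 0 \<longleftrightarrow> (AE x in lebesgue. f x = 0)"
      using X unfolding function_space_axioms_def by (elim conjE)
    have "bounded (cube s k) \<and> cube s k \<in> sets lebesgue"
      using bounded_cube[OF s] by simp
    then have "indicator (cube s k) \<in> carrier_of X" using B4 by blast
    moreover have ind: "(\<lambda>x. ereal (indicator (cube s k) x)) = indicator (cube s k)"
      by (auto simp: indicator_def fun_eq_iff)
    ultimately have mem: "(\<lambda>x. ereal (indicator (cube s k) x)) \<in> L_class"
      and fin: "X (\<lambda>x. ereal (indicator (cube s k) x)) < \<infinity>"
      by (auto simp: carrier_of_def)
    have "\<not> (AE x in lebesgue. ereal (indicator (cube s k) x) = 0)"
    proof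
      assume "AE x in lebesgue. ereal (indicator (cube s k) x) = 0"
      then have "AE x in lborel. x \<notin> cube s k"
        by (simp add: AE_completion_iff indicator_def)
      then have "emeasure lborel (cube s k) = 0"
        by (subst (asm) AE_iff_measurable[where N="cube s k"]) auto
      then show False using measure_cube_pos[OF s, of k] by (simp add: measure_def)
    qed
    then have "X (\<lambda>x. ereal (indicator (cube s k) x)) \<noteq> 0" by (simp only: B0[rule_format, OF mem] not_False_eq_True)
    with fin show ?thesis
      by (cases "X (\<lambda>x. ereal (indicator (cube s k) x))") (auto simp: less_le)
  qed
  then obtain q where q: "\<And>k. 0 < q k" "\<And>k. X (\<lambda>x. ereal (indicator (cube s k) x)) = ennreal (q k)"
    by metis
  have X_cube: "X (\<lambda>x. ereal (\<bar>c\<bar> powr b * indicator (cube s k) x)) = ennreal (\<bar>c\<bar> powr b * q k)" for c k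
    using q(1)[of k] by (subst BFS_scale[OF BFS]) (auto simp: q(2) ennreal_mult)
  have X_step: "X (\<lambda>x. ereal (\<bar>step s J d x\<bar> powr b)) \<le> ennreal (\<Sum>k\<in>J. \<bar>d k\<bar> powr b * q k)" for d
  proof -
    have "X (\<lambda>x. ereal (\<bar>step s J d x\<bar> powr b)) \<le>
        (\<Sum>k\<in>J. X (\<lambda>x. ereal (\<bar>d k\<bar> powr b * indicator (cube s k) x)))"
      unfolding step_powr[OF J] by (intro BFS_sum[OF BFS J]) measurable
    also have "\<dots> = ennreal (\<Sum>k\<in>J. \<bar>d k\<bar> powr b * q k)"
      unfolding X_cube using q(1) by (intro sum_ennreal) (simp add: less_imp_le)
    finally show ?thesis .
  qed

  \<comment> \<open>\<open>L k\<close> will bound the medians on cube \<open>k\<close> for all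
    \<open>f\<close> at once. The mesh \<open>t k\<close> lets each of the \<open>card J\<close>
    cubes contribute at most \<open>a / card J\<close> when medians are rounded.\<close>
  define L where "L k = ((B powr b + a) / q k) powr (1 / b)" for k
  define t where "t k = (a / (card J * q k)) powr (1 / b)" for k
  have card: "0 < card J" using J J_ne by (simp add: card_gt_0_iff)
  have "\<exists>D. finite D \<and> (\<forall>m. \<bar>m\<bar> \<le> L k \<longrightarrow> (\<exists>d\<in>D. \<bar>m - d\<bar> < t k))" for k
    using finite_net_interval[of "t k" "L k"] a card q(1)[of k] by (simp add: t_def)
  then obtain D where D: "\<And>k. finite (D k)"
    "\<And>k m. \<bar>m\<bar> \<le> L k \<Longrightarrow> \<exists>d\<in>D k. \<bar>m - d\<bar> < t k" by metis
  \<comment> \<open>\<open>PiE\<close> fixes the coefficients off \<open>J\<close>, so only finitely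
    many choices remain.\<close>
  define K where "K = (\<lambda>d x. ereal (step s J d x)) ` PiE J D"
  have "finite K" unfolding K_def using J D(1) by (intro finite_imageI finite_PiE) auto
  moreover have "K \<subseteq> carrier_of N"
  proof
    fix g assume "g \<in> K"
    then obtain d where g: "g = (\<lambda>x. ereal (step s J d x))" by (auto simp: K_def)
    have "ennreal_power (N g) b \<le> ennreal (\<Sum>k\<in>J. \<bar>d k\<bar> powr b * q k)"
      using X_step[of d] unfolding g by (simp add: X_powr)
    then have "N g < \<infinity>" by (auto simp: ennreal_power_def less_top top_unique split: if_splits)
    then show "g \<in> carrier_of N" by (auto simp: carrier_of_def g)
  qed
  moreover have "\<exists>g\<in>K. N (\<lambda>x. f x - g x) < ennreal \<epsilon>" if f: "f \<in> \<F>" for f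
  proof -
    have fL: "f \<in> L_class" and fN: "f \<in> carrier_of N" using f assms(3) by (auto simp: carrier_of_def)
    note [measurable] = L_class_measurable[OF fL]
    obtain f0 where [measurable]: "f0 \<in> borel_measurable borel" and ae: "AE x in lebesgue. f x = ereal (f0 x)"
      using borel_representative[OF N b(1) L0 fN] by blast

    have "N (\<lambda>x. ereal (f0 x)) = N f"
      using ae fL by (intro gauge_cong_AE[OF N]) auto
    also have "\<dots> \<le> ennreal B" using f B(2) by (metis SUP_upper)
    finally have "X (\<lambda>x. ereal (\<bar>f0 x\<bar> powr b)) \<le> ennreal (B powr b)"
      using B(1) b(1) by (intro X_powr_le) (auto simp: powr_powr)
    note f0_bound = this

    \<comment> \<open>The tail \<open>f1\<close> carries the error of replacing \<open>f0\<close> by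
      0 outside the cubes of \<open>J\<close>.\<close>
    define f1 where "f1 x = f0 x * indicator (- ball 0 R) x" for x
    have [measurable]: "f1 \<in> borel_measurable borel" unfolding f1_def by measurable
    have "N (\<lambda>x. ereal (f1 x)) = N (restrict_fn (- ball 0 R) f)"
    proof (rule gauge_cong_AE[OF N])
      have "indicator (- ball 0 R) \<in> borel_measurable lebesgue"
        by (intro borel_measurable_indicator) auto
      then show "restrict_fn (- ball 0 R) f \<in> L_class"
        unfolding L_class_def restrict_fn_def by measurable
      show "AE x in lebesgue. ereal (f1 x) = restrict_fn (- ball 0 R) f x"
        using ae by eventually_elim (auto simp: f1_def restrict_fn_def indicator_def)
    qed auto
    also have "\<dots> \<le> (SUP f\<in>\<F>. N (restrict_fn (- ball 0 R) f))"
      by (rule SUP_upper2[OF f order_refl])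
    also have "\<dots> \<le> ennreal (a powr (1 / b))" using R by (rule less_imp_le)
    finally have f1_bound: "X (\<lambda>x. ereal (\<bar>f1 x\<bar> powr b)) \<le> ennreal a"
      using a by (intro X_powr_le) auto

    have osc: "X (\<lambda>x. ereal (\<bar>f0 (x - y) - f0 x\<bar> powr b)) \<le> ennreal (a / C)"
      if y: "y \<in> cbox (- (\<chi> i. s)) (\<chi> i. s)" for y
    proof (rule X_powr_le)
      have "N (\<lambda>x. ereal (f0 (x - y) - f0 x)) = N (\<lambda>x. translate y f x - f x)"
      proof (rule gauge_cong_AE[OF N])
        note [measurable] = L_class_measurable[OF L_class_translate[OF fL, of y]]
        show "(\<lambda>x. translate y f x - f x) \<in> L_class" unfolding L_class_def by measurable
        have "AE x in lborel. f (x - y) = ereal (f0 (x - y))"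
          using ae by (intro AE_lborel_translate) (simp add: AE_completion_iff)
        then have "AE x in lebesgue. f (x - y) = ereal (f0 (x - y))" by (rule AE_completion)
        with ae show "AE x in lebesgue. ereal (f0 (x - y) - f0 x) = translate y f x - f x"
          by eventually_elim (simp add: translate_def)
      qed auto
      also have "\<dots> \<le> (SUP f\<in>\<F>. SUP y\<in>ball 0 r. N (\<lambda>x. translate y f x - f x))"
        by (rule SUP_upper2[OF f], rule SUP_upper2[OF subsetD[OF small y] order_refl])
      also have "\<dots> \<le> ennreal ((a / C) powr (1 / b))" using r(2) by (rule less_imp_le)
      finally show "N (\<lambda>x. ereal (f0 (x - y) - f0 x)) \<le> ennreal ((a / C) powr (1 / b))" .
    qed (use a C in auto)
    obtain m where "X (\<lambda>x. ereal (\<bar>f0 x - step s J m x\<bar> powr b * indicator U x))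
        \<le> ennreal (2 ^ (CARD('n) + 1) * (a / C))"
      using BFS_median_approximation[OF BFS b(1) _ s J J_ne _ osc] a C unfolding U_def by auto
    moreover have "2 ^ (CARD('n) + 1) * (a / C) = a" unfolding C_def by simp
    ultimately have m: "X (\<lambda>x. ereal (\<bar>f0 x - step s J m x\<bar> powr b * indicator U x)) \<le> ennreal a"
      by simp

    \<comment> \<open>On the cube \<open>k\<close> the constant \<open>m k\<close> is controlled by
      \<open>f0\<close> and its deviation from the median; dividing by \<open>q k\<close> turns the
      norm bound into a bound on a number.\<close>
    have "\<bar>m k\<bar> \<le> L k" if k: "k \<in> J" for k
    proof -
      have "X (\<lambda>x. ereal (\<bar>m k\<bar> powr b * indicator (cube s k) x)) \<le>
          X (\<lambda>x. ereal (\<bar>f0 x\<bar> powr b + \<bar>f0 x - step s J m x\<bar> powr b * indicator U x))"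
      proof (intro gauge_mono[OF X] L_class_ereal AE_I2)
        fix x
        have "\<bar>m k\<bar> powr b \<le> \<bar>f0 x\<bar> powr b + \<bar>f0 x - m k\<bar> powr b"
          using powr_subadd[OF b, of "f0 x" "m k - f0 x"] by (simp add: abs_minus_commute)
        then show "\<bar>ereal (\<bar>m k\<bar> powr b * indicator (cube s k) x)\<bar>
            \<le> \<bar>ereal (\<bar>f0 x\<bar> powr b + \<bar>f0 x - step s J m x\<bar> powr b * indicator U x)\<bar>"
          using k by (auto simp: indicator_def U mem_cube step_eq[OF J])
      qed measurable
      also have "\<dots> \<le> X (\<lambda>x. ereal (\<bar>f0 x\<bar> powr b)) + X (\<lambda>x. ereal (\<bar>f0 x - step s J m x\<bar> powr b * indicator U x))"
        by (rule BFS_triangle[OF BFS]) measurable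
      also have "\<dots> \<le> ennreal (B powr b) + ennreal a" by (intro add_mono f0_bound m)
      also have "\<dots> = ennreal (B powr b + a)" using a by simp
      finally have "\<bar>m k\<bar> powr b * q k \<le> B powr b + a"
        using a unfolding X_cube by (subst (asm) ennreal_le_iff) (auto simp: add_nonneg_nonneg)
      then have "\<bar>m k\<bar> powr b \<le> (B powr b + a) / q k" using q(1)[of k] by (simp add: field_simps)
      then have "(\<bar>m k\<bar> powr b) powr (1 / b) \<le> L k"
        unfolding L_def using b by (intro powr_mono2) auto
      then show ?thesis using b by (simp add: powr_powr)
    qed
    then have "\<forall>k\<in>J. \<exists>d\<in>D k. \<bar>m k - d\<bar> < t k" using D(2) by blast
    then obtain d where d: "\<And>k. k \<in> J \<Longrightarrow> d k \<in> D k" "\<And>k. k \<in> J \<Longrightarrow> \<bar>m k - d k\<bar> < t k" by metis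
    \<comment> \<open>Restriction to \<open>J\<close> gives an element of \<open>PiE J D\<close>
      without changing the step function.\<close>
    define e where "e = restrict d J"
    have e: "e \<in> PiE J D" using d(1) by (auto simp: e_def)
    have "\<bar>m k - e k\<bar> powr b * q k \<le> a / card J" if "k \<in> J" for k
    proof -
      have "\<bar>m k - e k\<bar> powr b \<le> t k powr b"
        using d(2)[OF that] that b by (intro powr_mono2) (auto simp: e_def)
      also have "\<dots> = a / (card J * q k)"
        using a b q(1)[of k] by (simp add: t_def powr_powr)
      finally show ?thesis using q(1)[of k] card by (simp add: field_simps)
    qed
    then have "(\<Sum>k\<in>J. \<bar>m k - e k\<bar> powr b * q k) \<le> (\<Sum>k\<in>J. a / card J)" by (rule sum_mono)
    then have "(\<Sum>k\<in>J. \<bar>m k - e k\<bar> powr b * q k) \<le> a" using card by simp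
    then have e_bound: "X (\<lambda>x. ereal (\<bar>step s J m x - step s J e x\<bar> powr b)) \<le> ennreal a"
      unfolding step_diff using X_step[of "\<lambda>k. m k - e k"] by (meson ennreal_leI order_trans)

    \<comment> \<open>On \<open>U\<close> the error splits into median approximation
      \<open>?B\<close> and rounding \<open>?C\<close>. Off \<open>U\<close> the step function is 0
      and the point lies outside \<open>ball 0 R\<close>, so the tail \<open>?A\<close> is the whole
      error.\<close>
    let ?A = "\<lambda>x. \<bar>f1 x\<bar> powr b" and ?B = "\<lambda>x. \<bar>f0 x - step s J m x\<bar> powr b * indicator U x"
      and ?C = "\<lambda>x. \<bar>step s J m x - step s J e x\<bar> powr b"
    have "X (\<lambda>x. ereal (\<bar>f0 x - step s J e x\<bar> powr b)) \<le> X (\<lambda>x. ereal (?A x + (?B x + ?C x)))"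
    proof (intro gauge_mono[OF X] L_class_ereal AE_I2)
      fix x
      have "\<bar>f0 x - step s J e x\<bar> powr b \<le> ?A x + (?B x + ?C x)"
      proof (cases "cell s x \<in> J")
        case True
        then have "x \<in> U" by (simp add: U)
        then show ?thesis
          using powr_subadd[OF b, of "f0 x - step s J m x" "step s J m x - step s J e x"]
          by (simp add: add_increasing)
      next
        case False
        with outside[OF False] show ?thesis by (simp add: step_eq[OF J] f1_def)
      qed
      then show "\<bar>ereal (\<bar>f0 x - step s J e x\<bar> powr b)\<bar> \<le> \<bar>ereal (?A x + (?B x + ?C x))\<bar>"
        by simp
    qed measurable
    also have "\<dots> \<le> X (\<lambda>x. ereal (?A x)) + X (\<lambda>x. ereal (?B x + ?C x))"
      by (rule BFS_triangle[OF BFS]) measurable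
    also have "\<dots> \<le> X (\<lambda>x. ereal (?A x)) + (X (\<lambda>x. ereal (?B x)) + X (\<lambda>x. ereal (?C x)))"
      by (intro add_left_mono BFS_triangle[OF BFS]) measurable
    also have "\<dots> \<le> ennreal a + (ennreal a + ennreal a)"
      by (intro add_mono f1_bound m e_bound)
    also have "\<dots> = ennreal (3 * a)" using a by (simp add: ennreal_plus[symmetric] del: ennreal_plus)
    also have "\<dots> < ennreal (\<epsilon> powr b)" using \<epsilon> by (intro ennreal_lessI) (auto simp: a_def)
    finally have "ennreal_power (N (\<lambda>x. ereal (f0 x - step s J e x))) b < ennreal (\<epsilon> powr b)"
      by (subst (asm) X_powr) auto
    then have "N (\<lambda>x. ereal (f0 x - step s J e x)) < ennreal \<epsilon>"
      by (rule ennreal_power_less_D[OF b(1) less_imp_le[OF \<epsilon>]])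
    also have "N (\<lambda>x. ereal (f0 x - step s J e x)) = N (\<lambda>x. f x - ereal (step s J e x))"
    proof (rule gauge_cong_AE[OF N])
      note [measurable] = L_class_measurable[OF L_class_ereal[OF step_borel[of s J e]]]
      show "(\<lambda>x. f x - ereal (step s J e x)) \<in> L_class" unfolding L_class_def by measurable
      show "AE x in lebesgue. ereal (f0 x - step s J e x) = f x - ereal (step s J e x)"
        using ae by eventually_elim simp
    qed auto
    finally show ?thesis using e by (intro bexI[of _ "\<lambda>x. ereal (step s J e x)"]) (auto simp: K_def)
  qed
  ultimately show "\<exists>K. finite K \<and> K \<subseteq> carrier_of N \<and> (\<forall>f\<in>\<F>. \<exists>g\<in>K. N (\<lambda>x. f x - g x) < ennreal \<epsilon>)"
    by blast
qed

end
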